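(* For every instance of House Allocation (with ties allowed) and every order $\sigma$ of the agents, the matching produced by SDMT-1 (defined in the context) is a Pareto optimal matching.
   Context: House Allocation (HA). $N$ is a finite set of agents, $O$ a finite set of objects with $|O|=n_2$. Each agent $i$ has a preference list $L(i)=(C^i_1\succ_i C^i_2\succ_i\cdots)$, an ordered sequence of pairwise disjoint subsets of $O$ (indifference classes, all nonempty classes coming first); objects in $C^i_k$ are strictly preferred to those in $C^i_l$ for $k<l$, and $i$ is indifferent between objects in the same class. Objects in $\bigcup_k C^i_k$ are acceptable to $i$. $rank(i,o)=k$ if $o\in C^i_k$, and $n_2+1$ if $o$ is unacceptable or if $i$ is unmatched; $i$ prefers smaller rank. A matching is a set of (agent, acceptable object) pairs in which every agent and every object occurs at most once. $\mu$ is Pareto optimal if there is no matching $\mu'$ with $\mu'(i)\succeq_i\mu(i)$ for all $i$ and $\mu'(i')\succ_{i'}\mu(i')$ for some $i'$. SDMT-1, given an order $\sigma$ of the agents: start with the bipartite graph $G=(N\cup O,E)$, $E=\emptyset$, and $\mu=\emptyset$. Process agents in the order $\sigma$. For the current agent $i$, for $\ell=1,2,\dots$ while $C^i_\ell\neq\emptyset$: add the edges $\{(i,o):o\in C^i_\ell\}$ to $E$; if $G$ contains an augmenting path with respect to $\mu$ starting at $i$ (a path from $i$ to an unmatched object, alternating between edges not in $\mu$ and edges in $\mu$), choose any such path, replace $\mu$ by its symmetric difference with the path, and go to the next agent; otherwise remove the edges just added and increase $\ell$ by one. Return $\mu$ after all agents are processed. The choice of augmenting paths is arbitrary. *)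

theory Defs
  imports Main
begin

text \<open>
  An instance consists of the agents \<open>N\<close>, the objects \<open>Ob\<close> and the preference lists, where
  \<open>C i k\<close> is the \<open>k\<close>-th indifference class of agent \<open>i\<close>. Classes are numbered from 1;
  the value \<open>C i 0\<close> is never used. A preference list with finitely many classes is
  continued by empty classes.
\<close>

definition house_allocation :: "'a set \<Rightarrow> 'o set \<Rightarrow> ('a \<Rightarrow> nat \<Rightarrow> 'o set) \<Rightarrow> bool" where
  "house_allocation N Ob C \<longleftrightarrow>
     finite N \<and> finite Ob \<and>
     (\<forall>i\<in>N. \<forall>k\<ge>1. C i k \<subseteq> Ob) \<and>
     (\<forall>i\<in>N. \<forall>k\<ge>1. \<forall>l\<ge>1. k \<noteq> l \<longrightarrow> C i k \<inter> C i l = {}) \<and>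
     (\<forall>i\<in>N. \<forall>k\<ge>1. \<forall>l\<ge>k. C i k = {} \<longrightarrow> C i l = {})"

definition acceptable :: "('a \<Rightarrow> nat \<Rightarrow> 'o set) \<Rightarrow> 'a \<Rightarrow> 'o set" where
  "acceptable C i = (\<Union>k\<in>{1..}. C i k)"

text \<open>The argument \<open>None\<close> of \<open>rank\<close> stands for being unmatched.\<close>

definition rank :: "'o set \<Rightarrow> ('a \<Rightarrow> nat \<Rightarrow> 'o set) \<Rightarrow> 'a \<Rightarrow> 'o option \<Rightarrow> nat" where
  "rank Ob C i z =
     (case z of
        None \<Rightarrow> card Ob + 1
      | Some x \<Rightarrow> (if x \<in> acceptable C i then (THE k. 1 \<le> k \<and> x \<in> C i k) else card Ob + 1))"

definition is_matching :: "'a set \<Rightarrow> ('a \<Rightarrow> nat \<Rightarrow> 'o set) \<Rightarrow> ('a \<times> 'o) set \<Rightarrow> bool" where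
  "is_matching N C \<mu> \<longleftrightarrow>
     (\<forall>(i, x)\<in>\<mu>. i \<in> N \<and> x \<in> acceptable C i) \<and>
     (\<forall>i x y. (i, x) \<in> \<mu> \<and> (i, y) \<in> \<mu> \<longrightarrow> x = y) \<and>
     (\<forall>i j x. (i, x) \<in> \<mu> \<and> (j, x) \<in> \<mu> \<longrightarrow> i = j)"

definition partner :: "('a \<times> 'o) set \<Rightarrow> 'a \<Rightarrow> 'o option" where
  "partner \<mu> i = (if \<exists>x. (i, x) \<in> \<mu> then Some (THE x. (i, x) \<in> \<mu>) else None)"

definition weakly_prefers ::
  "'o set \<Rightarrow> ('a \<Rightarrow> nat \<Rightarrow> 'o set) \<Rightarrow> 'a \<Rightarrow> 'o option \<Rightarrow> 'o option \<Rightarrow> bool" where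
  "weakly_prefers Ob C i y z \<longleftrightarrow> rank Ob C i y \<le> rank Ob C i z"

definition strictly_prefers ::
  "'o set \<Rightarrow> ('a \<Rightarrow> nat \<Rightarrow> 'o set) \<Rightarrow> 'a \<Rightarrow> 'o option \<Rightarrow> 'o option \<Rightarrow> bool" where
  "strictly_prefers Ob C i y z \<longleftrightarrow> rank Ob C i y < rank Ob C i z"

definition pareto_optimal ::
  "'a set \<Rightarrow> 'o set \<Rightarrow> ('a \<Rightarrow> nat \<Rightarrow> 'o set) \<Rightarrow> ('a \<times> 'o) set \<Rightarrow> bool" where
  "pareto_optimal N Ob C \<mu> \<longleftrightarrow>
     \<not> (\<exists>\<mu>'. is_matching N C \<mu>' \<and>
            (\<forall>i\<in>N. weakly_prefers Ob C i (partner \<mu>' i) (partner \<mu> i)) \<and>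
            (\<exists>i\<in>N. strictly_prefers Ob C i (partner \<mu>' i) (partner \<mu> i)))"

text \<open>
  The vertices of the bipartite graph are \<open>Inl i\<close> for agents and \<open>Inr x\<close> for objects, and a path
  is the list of its vertices. An undirected edge between \<open>Inl i\<close> and \<open>Inr x\<close> is represented by
  the pair \<open>(i, x)\<close>, whichever way a path traverses it.
\<close>

definition path_edges :: "('a + 'o) list \<Rightarrow> ('a \<times> 'o) set" where
  "path_edges p = {(i, x). \<exists>k. Suc k < length p \<and> {p ! k, p ! Suc k} = {Inl i, Inr x}}"

definition augmenting_path ::
  "('a \<times> 'o) set \<Rightarrow> ('a \<times> 'o) set \<Rightarrow> 'a \<Rightarrow> ('a + 'o) list \<Rightarrow> bool" where
  "augmenting_path E \<mu> i p \<longleftrightarrow>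
     p \<noteq> [] \<and> distinct p \<and> hd p = Inl i \<and> (\<exists>x. last p = Inr x \<and> x \<notin> Range \<mu>) \<and>
     (\<forall>k. Suc k < length p \<longrightarrow>
        (\<exists>j x. {p ! k, p ! Suc k} = {Inl j, Inr x} \<and> (j, x) \<in> E \<and> ((j, x) \<in> \<mu> \<longleftrightarrow> odd k)))"

text \<open>
  \<open>process_agent C i l E \<mu> E' \<mu>'\<close>: the inner loop of SDMT-1 for agent \<open>i\<close>, entered at class \<open>l\<close> with
  edge set \<open>E\<close> and matching \<open>\<mu>\<close>, may terminate with \<open>E'\<close> and \<open>\<mu>'\<close>. It is a relation because the
  augmenting path is chosen arbitrarily.
\<close>

inductive process_agent ::
  "('a \<Rightarrow> nat \<Rightarrow> 'o set) \<Rightarrow> 'a \<Rightarrow> nat \<Rightarrow> ('a \<times> 'o) set \<Rightarrow> ('a \<times> 'o) set \<Rightarrow>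
   ('a \<times> 'o) set \<Rightarrow> ('a \<times> 'o) set \<Rightarrow> bool"
  for C :: "'a \<Rightarrow> nat \<Rightarrow> 'o set" and i :: 'a where
  exhausted: "C i l = {} \<Longrightarrow> process_agent C i l E \<mu> E \<mu>"
| augment: "\<lbrakk>C i l \<noteq> {}; augmenting_path (E \<union> {i} \<times> C i l) \<mu> i p\<rbrakk> \<Longrightarrow>
    process_agent C i l E \<mu> (E \<union> {i} \<times> C i l) (sym_diff \<mu> (path_edges p))"
| next_class: "\<lbrakk>C i l \<noteq> {}; \<nexists>p. augmenting_path (E \<union> {i} \<times> C i l) \<mu> i p;
     process_agent C i (l + 1) E \<mu> E' \<mu>'\<rbrakk> \<Longrightarrow> process_agent C i l E \<mu> E' \<mu>'"

inductive process_agents ::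
  "('a \<Rightarrow> nat \<Rightarrow> 'o set) \<Rightarrow> 'a list \<Rightarrow> ('a \<times> 'o) set \<Rightarrow> ('a \<times> 'o) set \<Rightarrow>
   ('a \<times> 'o) set \<Rightarrow> ('a \<times> 'o) set \<Rightarrow> bool"
  for C :: "'a \<Rightarrow> nat \<Rightarrow> 'o set" where
  "process_agents C [] E \<mu> E \<mu>"
| "\<lbrakk>process_agent C i 1 E \<mu> E' \<mu>'; process_agents C is E' \<mu>' E'' \<mu>''\<rbrakk> \<Longrightarrow>
    process_agents C (i # is) E \<mu> E'' \<mu>''"

definition sdmt1_returns ::
  "('a \<Rightarrow> nat \<Rightarrow> 'o set) \<Rightarrow> 'a list \<Rightarrow> ('a \<times> 'o) set \<Rightarrow> bool" where
  "sdmt1_returns C \<sigma> \<mu> \<longleftrightarrow> (\<exists>E. process_agents C \<sigma> {} {} E \<mu>)"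

text \<open>The relation is not vacuous: on every instance SDMT-1 returns some \<open>\<mu>\<close>.\<close>

lemma process_agent_total:
  assumes "C i m = {}" and "l \<le> m"
  shows "\<exists>E' \<mu>'. process_agent C i l E \<mu> E' \<mu>'"
  using assms(2)
proof (induction rule: inc_induct)
  case base
  show ?case using exhausted[of C i m] assms(1) by blast
next
  case (step n)
  then obtain E' \<mu>' where IH: "process_agent C i (n + 1) E \<mu> E' \<mu>'" by auto
  show ?case
  proof (cases "C i n = {}")
    case True
    then show ?thesis by (blast intro: exhausted)
  next
    case False
    show ?thesis
    proof (cases "\<exists>p. augmenting_path (E \<union> {i} \<times> C i n) \<mu> i p")
      case True
      then obtain p where "augmenting_path (E \<union> {i} \<times> C i n) \<mu> i p" by (rule exE)
      from augment[where C = C, OF False this] show ?thesis by (intro exI)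
    next
      case no_path: False
      from next_class[where C = C, OF False no_path IH] show ?thesis by (intro exI)
    qed
  qed
qed

lemma ex_empty_class:
  assumes ha: "house_allocation N Ob C" and i: "i \<in> N"
  shows "\<exists>m\<ge>1. C i m = {}"
proof (rule ccontr)
  assume *: "\<not> ?thesis"
  define f where "f k = (SOME x. x \<in> C i (Suc k))" for k
  have f: "f k \<in> C i (Suc k)" for k
  proof -
    have "C i (Suc k) \<noteq> {}" using * by (metis le_add1 plus_1_eq_Suc)
    then show ?thesis unfolding f_def by (simp add: some_in_eq)
  qed
  have "inj f"
  proof (rule injI)
    fix k l assume "f k = f l"
    then have "C i (Suc k) \<inter> C i (Suc l) \<noteq> {}" using f[of k] f[of l] by auto
    moreover have "\<forall>k\<ge>1. \<forall>l\<ge>1. k \<noteq> l \<longrightarrow> C i k \<inter> C i l = {}"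
      using ha i unfolding house_allocation_def by blast
    ultimately have "Suc k = Suc l" by (metis le_add1 plus_1_eq_Suc)
    then show "k = l" by simp
  qed
  moreover have "C i (Suc k) \<subseteq> Ob" for k
    using ha i by (simp add: house_allocation_def)
  then have "range f \<subseteq> Ob" using f by (meson image_subsetI subsetD)
  moreover have "finite Ob" using ha by (simp add: house_allocation_def)
  ultimately show False by (meson finite_imageD finite_subset infinite_UNIV_nat)
qed

lemma process_agents_total:
  assumes "house_allocation N Ob C" and "set \<sigma> \<subseteq> N"
  shows "\<exists>E' \<mu>'. process_agents C \<sigma> E \<mu> E' \<mu>'"
  using assms(2)
proof (induction \<sigma> arbitrary: E \<mu>)
  case Nil
  show ?case using process_agents.intros(1) by blast
next
  case (Cons i \<sigma>)
  obtain m where "m \<ge> 1" "C i m = {}"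
    using ex_empty_class[OF assms(1), of i] Cons.prems by (meson list.set_intros(1) subsetD)
  then obtain E1 \<mu>1 where "process_agent C i 1 E \<mu> E1 \<mu>1"
    using process_agent_total by meson
  moreover obtain E2 \<mu>2 where "process_agents C \<sigma> E1 \<mu>1 E2 \<mu>2"
    using Cons.IH[of E1 \<mu>1] Cons.prems by auto
  ultimately have "process_agents C (i # \<sigma>) E \<mu> E2 \<mu>2"
    by (rule process_agents.intros(2))
  then show ?case by (intro exI)
qed

lemma sdmt1_returns_total:
  assumes "house_allocation N Ob C" and "set \<sigma> \<subseteq> N"
  shows "\<exists>\<mu>. sdmt1_returns C \<sigma> \<mu>"
  using process_agents_total[OF assms] unfolding sdmt1_returns_def by blast

end

theory Submission
  imports Defs
begin

text \<open>
  After every agent, the rank profile of the current matching \<open>\<mu>\<close> is Pareto optimal among the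
  processed agents. Indeed, let a matching \<open>M\<close> be weakly better for all agents up to the current
  agent \<open>i\<close>. By induction it gives every earlier agent a rank equal to that in \<open>\<mu>\<close>, so its edges at
  the matched agents already lie in the graph. If \<open>M\<close> gave \<open>i\<close> an object of an earlier class \<open>k\<close>,
  then alternating between \<open>M\<close> and \<open>\<mu>\<close> from \<open>i\<close> would yield an augmenting path at the time class
  \<open>k\<close> was tried. Augmenting only moves agents within the single class that their edges belong to,
  so it preserves all ranks assigned earlier.
\<close>

section \<open>Augmenting paths, decomposed two edges at a time\<close>

lemma path_edges_singleton [simp]: "path_edges [v] = {}"
  by (auto simp: path_edges_def)

lemma path_edges_Cons_Cons:
  "path_edges (u # v # p) = {(i, x). {u, v} = {Inl i, Inr x}} \<union> path_edges (v # p)"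
proof (intro set_eqI, clarify)
  fix i x
  have split: "(\<exists>k. P k) \<longleftrightarrow> P 0 \<or> (\<exists>k. P (Suc k))" for P
    by (metis not0_implies_Suc)
  show "(i, x) \<in> path_edges (u # v # p) \<longleftrightarrow>
    (i, x) \<in> {(i, x). {u, v} = {Inl i, Inr x}} \<union> path_edges (v # p)"
    unfolding path_edges_def by (simp, subst split, simp)
qed

lemma path_edges_vertices:
  assumes "(i, x) \<in> path_edges p"
  shows "Inl i \<in> set p \<and> Inr x \<in> set p"
proof -
  obtain k where k: "Suc k < length p" "{p ! k, p ! Suc k} = {Inl i, Inr x}"
    using assms unfolding path_edges_def by blast
  then have "p ! k \<in> set p" "p ! Suc k \<in> set p" by auto
  then show ?thesis using k(2) by (metis doubleton_eq_iff)
qed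

lemma augmenting_path_single:
  "augmenting_path E \<mu> i [Inl i, Inr x] \<longleftrightarrow> (i, x) \<in> E - \<mu> \<and> x \<notin> Range \<mu>"
  by (auto simp: augmenting_path_def doubleton_eq_iff)

text \<open>This is the recursion behind both inductions on paths below. Deleting the matched edge
  \<open>(j, x)\<close> leaves \<open>j\<close> unmatched, so the rest of the path is again
  augmenting, now from \<open>j\<close>. Conversely, two edges can be put in front of such a path if
  \<open>i\<close> and \<open>x\<close> do not occur on it.\<close>

lemma augmenting_path_step:
  "augmenting_path E \<mu> i (Inl i # Inr x # Inl j # p) \<longleftrightarrow>
     (i, x) \<in> E - \<mu> \<and> (j, x) \<in> E \<inter> \<mu> \<and>
     Inl i \<notin> set (Inl j # p) \<and> Inr x \<notin> set p \<and>
     augmenting_path E (\<mu> - {(j, x)}) j (Inl j # p)"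
proof -
  define q where "q = Inl j # p"
  define step where "step \<mu> p k \<longleftrightarrow> (Suc k < length p \<longrightarrow>
        (\<exists>j x. {p ! k, p ! Suc k} = {Inl j, Inr x} \<and> (j, x) \<in> E \<and> ((j, x) \<in> \<mu> \<longleftrightarrow> odd k)))"
    for \<mu> and p :: "('a + 'b) list" and k
  have aug: "augmenting_path E \<mu> i p \<longleftrightarrow> p \<noteq> [] \<and> distinct p \<and> hd p = Inl i \<and>
      (\<exists>x. last p = Inr x \<and> x \<notin> Range \<mu>) \<and> (\<forall>k. step \<mu> p k)" for \<mu> i p
    unfolding augmenting_path_def step_def ..
  \<comment> \<open>Dropping two vertices preserves the parity of positions, and this parity decides
    which edges must be matched.\<close>
  have split: "(\<forall>k. P k) \<longleftrightarrow> P 0 \<and> P 1 \<and> (\<forall>k. P (Suc (Suc k)))" for P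
    by (metis not0_implies_Suc One_nat_def)
  have 0: "step \<mu> (Inl i # Inr x # q) 0 \<longleftrightarrow> (i, x) \<in> E - \<mu>"
    by (auto simp: step_def doubleton_eq_iff)
  have 1: "step \<mu> (Inl i # Inr x # q) 1 \<longleftrightarrow> (j, x) \<in> E \<inter> \<mu>"
    by (auto simp: step_def q_def doubleton_eq_iff)
  have 2: "step \<mu> (Inl i # Inr x # q) (Suc (Suc k)) \<longleftrightarrow> step (\<mu> - {(j, x)}) q k"
    if "Inr x \<notin> set q" for k
  proof -
    \<comment> \<open>No edge of the tail touches \<open>x\<close>, so removing
      \<open>(j, x)\<close> from the matching does not change which of its edges are
      matched.\<close>
    have ne: "x' \<noteq> x" if "Suc k < length q" "{q ! k, q ! Suc k} = {Inl j', Inr x'}" for j' x'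
    proof -
      have "q ! k \<in> set q" "q ! Suc k \<in> set q" using that(1) by auto
      then have "Inr x' \<in> set q" using that(2) by (metis doubleton_eq_iff)
      then show ?thesis using \<open>Inr x \<notin> set q\<close> by auto
    qed
    show ?thesis unfolding step_def using ne by simp blast
  qed
  \<comment> \<open>At most the object \<open>x\<close> becomes free by the removal, and the tail
    does not end there.\<close>
  have last: "(\<exists>y. last q = Inr y \<and> y \<notin> Range \<mu>) \<longleftrightarrow>
      (\<exists>y. last q = Inr y \<and> y \<notin> Range (\<mu> - {(j, x)}))" if "Inr x \<notin> set q"
  proof -
    have "last q \<noteq> Inr x" using that by (metis last_in_set list.distinct(1) q_def)
    then show ?thesis by auto
  qed
  have "q \<noteq> []" "hd q = Inl j" "Inr x \<notin> set q \<longleftrightarrow> Inr x \<notin> set p" by (auto simp: q_def)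
  then have "augmenting_path E \<mu> i (Inl i # Inr x # q) \<longleftrightarrow>
     (i, x) \<in> E - \<mu> \<and> (j, x) \<in> E \<inter> \<mu> \<and> Inl i \<notin> set q \<and> Inr x \<notin> set p \<and>
     augmenting_path E (\<mu> - {(j, x)}) j q"
    unfolding aug split[of "step \<mu> (Inl i # Inr x # q)"] 0 1 using 2 last by auto
  then show ?thesis by (simp add: q_def)
qed

lemma augmenting_path_cases:
  assumes "augmenting_path E \<mu> i p"
  obtains (single) x where "p = [Inl i, Inr x]"
    | (step) x j q where "p = Inl i # Inr x # Inl j # q"
proof -
  have ne: "p \<noteq> []" and hd: "hd p = Inl i" and last: "\<exists>x. last p = Inr x"
    and edges: "Suc k < length p \<Longrightarrow> \<exists>j x. {p ! k, p ! Suc k} = {Inl j, Inr x}" for k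
    using assms unfolding augmenting_path_def by blast+
  obtain v q where p: "p = Inl i # v # q"
    using ne hd last by (cases p rule: remdups_adj.cases) auto
  obtain x where x: "v = Inr x"
    using edges[of 0] p by (auto simp: doubleton_eq_iff)
  show thesis
  proof (cases q)
    case Nil
    then show thesis using single p x by simp
  next
    case (Cons w q')
    then obtain j where "w = Inl j"
      using edges[of 1] p x by (auto simp: doubleton_eq_iff)
    then show thesis using step p x Cons by simp
  qed
qed

lemma augmenting_path_mono:
  "augmenting_path E \<mu> i p \<Longrightarrow> E \<subseteq> E' \<Longrightarrow> augmenting_path E' \<mu> i p"
  unfolding augmenting_path_def by blast

section \<open>The effect of augmenting, and the existence of augmenting paths\<close>

text \<open>By induction on the length of the path: the tail augments the matching without
  \<open>(j, x)\<close>, which rematches \<open>j\<close> and keeps \<open>x\<close> free, so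
  \<open>(i, x)\<close> can be added. The equation for the domain records that no agent loses its
  match and only \<open>i\<close> gains one.\<close>

lemma augment_matching:
  assumes "augmenting_path E \<mu> i p" and "single_valued \<mu>" and "single_valued (\<mu>\<inverse>)"
    and "finite \<mu>" and "\<mu> \<subseteq> E" and "i \<notin> Domain \<mu>"
  shows "single_valued (sym_diff \<mu> (path_edges p)) \<and>
    single_valued ((sym_diff \<mu> (path_edges p))\<inverse>) \<and>
    finite (sym_diff \<mu> (path_edges p)) \<and> sym_diff \<mu> (path_edges p) \<subseteq> E \<and>
    Domain (sym_diff \<mu> (path_edges p)) = insert i (Domain \<mu>)"
  using assms
proof (induction "length p" arbitrary: \<mu> i p rule: less_induct)
  case less
  note sv = less.prems(2,3)
  from less.prems(1) show ?case
  proof (cases rule: augmenting_path_cases)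
    case (single x)
    have "path_edges p = {(i, x)}"
      unfolding single path_edges_Cons_Cons by (auto simp: doubleton_eq_iff)
    moreover have x: "(i, x) \<in> E" "(i, x) \<notin> \<mu>" "x \<notin> Range \<mu>"
      using less.prems(1) unfolding single augmenting_path_single by auto
    ultimately have "sym_diff \<mu> (path_edges p) = insert (i, x) \<mu>" by auto
    then show ?thesis using x less.prems by (auto simp: single_valued_def)
  next
    case (step x j q)
    define \<mu>' where "\<mu>' = \<mu> - {(j, x)}"
    define \<nu> where "\<nu> = sym_diff \<mu>' (path_edges (Inl j # q))"
    have st: "(i, x) \<in> E" "(i, x) \<notin> \<mu>" "(j, x) \<in> E" "(j, x) \<in> \<mu>" "Inl i \<notin> set (Inl j # q)"
      "Inr x \<notin> set (Inl j # q)" "augmenting_path E \<mu>' j (Inl j # q)"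
      using less.prems(1) unfolding step augmenting_path_step \<mu>'_def by auto
    have nin: "x \<notin> Range (path_edges (Inl j # q))"
      using path_edges_vertices st(6) by fastforce
    have "path_edges p = insert (i, x) (insert (j, x) (path_edges (Inl j # q)))"
      unfolding step path_edges_Cons_Cons[of "Inl i"] path_edges_Cons_Cons[of "Inr x"]
      by (auto simp: doubleton_eq_iff)
    \<comment> \<open>The edge \<open>(j, x)\<close> cancels and \<open>(i, x)\<close> is new; the
      tail affects neither, since it avoids \<open>x\<close>.\<close>
    then have eq: "sym_diff \<mu> (path_edges p) = insert (i, x) \<nu>"
      unfolding \<nu>_def \<mu>'_def using st nin by auto
    have \<mu>': "single_valued \<mu>'" "single_valued (\<mu>'\<inverse>)" "finite \<mu>'" "\<mu>' \<subseteq> E" "j \<notin> Domain \<mu>'"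
      "x \<notin> Range \<mu>'" "insert j (Domain \<mu>') = Domain \<mu>"
      using sv st(4) less.prems(4,5) unfolding \<mu>'_def single_valued_def by auto
    have "length (Inl j # q) < length p" by (simp add: step)
    then have \<nu>: "single_valued \<nu>" "single_valued (\<nu>\<inverse>)" "finite \<nu>" "\<nu> \<subseteq> E"
      "Domain \<nu> = Domain \<mu>"
      using less.hyps[OF _ st(7) \<mu>'(1-5)] \<mu>'(7) unfolding \<nu>_def by simp_all
    have "x \<notin> Range \<nu>" using \<mu>'(6) nin unfolding \<nu>_def by auto
    moreover have "i \<notin> Domain \<nu>" using \<nu>(5) less.prems(6) by simp
    ultimately show ?thesis
      unfolding eq using \<nu> st(1) by (auto simp: single_valued_def)
  qed
qed

text \<open>From \<open>i\<close> follow \<open>M\<close> to an object \<open>x\<close>. If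
  \<open>x\<close> is free, the path is complete; otherwise go back along the matched edge to an
  agent \<open>j\<close> and recurse with both edges deleted. The walk never gets stuck at an agent,
  because \<open>M\<close> covers \<open>i\<close> and all matched agents, and it ends because the
  matching shrinks. The bound on the vertices of the path is carried along to obtain
  distinctness.\<close>

lemma augmenting_path_exists:
  assumes "finite \<mu>" and "single_valued \<mu>" and "single_valued (\<mu>\<inverse>)"
    and "single_valued M" and "single_valued (M\<inverse>)"
    and "i \<notin> Domain \<mu>" and "insert i (Domain \<mu>) \<subseteq> Domain M"
  shows "\<exists>p. augmenting_path (M \<union> \<mu>) \<mu> i p \<and> set p \<subseteq> Inl ` Domain M \<union> Inr ` Range M"
  using assms
proof (induction "card \<mu>" arbitrary: \<mu> M i rule: less_induct)
  case less
  obtain x where x: "(i, x) \<in> M" using less.prems(7) by blast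
  show ?case
  proof (cases "x \<in> Range \<mu>")
    case False
    then have "augmenting_path (M \<union> \<mu>) \<mu> i [Inl i, Inr x]"
      unfolding augmenting_path_single using x by auto
    then show ?thesis using x by (intro exI[of _ "[Inl i, Inr x]"]) auto
  next
    case True
    then obtain j where j: "(j, x) \<in> \<mu>" by blast
    define \<mu>' M' where "\<mu>' = \<mu> - {(j, x)}" and "M' = M - {(i, x)}"
    have "card \<mu>' < card \<mu>"
      unfolding \<mu>'_def using less.prems(1) j by (rule card_Diff1_less)
    moreover have "finite \<mu>'" "single_valued \<mu>'" "single_valued (\<mu>'\<inverse>)"
      "single_valued M'" "single_valued (M'\<inverse>)" "j \<notin> Domain \<mu>'"
      using less.prems j unfolding \<mu>'_def M'_def single_valued_def by auto
    moreover have "insert j (Domain \<mu>') \<subseteq> Domain M'"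
      using less.prems(6,7) j unfolding \<mu>'_def M'_def by auto
    ultimately obtain p where p: "augmenting_path (M' \<union> \<mu>') \<mu>' j p"
      "set p \<subseteq> Inl ` Domain M' \<union> Inr ` Range M'"
      using less.hyps by blast
    obtain q where q: "p = Inl j # q"
      using p(1) unfolding augmenting_path_def by (metis list.collapse)
    \<comment> \<open>As \<open>M\<close> is a matching, deleting \<open>(i, x)\<close> uncovers
      both ends, so the path from the induction hypothesis cannot return to them.\<close>
    have "i \<notin> Domain M'" "x \<notin> Range M'"
      using less.prems(4,5) x unfolding M'_def single_valued_def by auto
    then have "Inl i \<notin> set p" "Inr x \<notin> set p" using p(2) by auto
    moreover have "augmenting_path (M \<union> \<mu>) \<mu>' j p"
      using p(1) by (rule augmenting_path_mono) (auto simp: \<mu>'_def M'_def)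
    ultimately have "augmenting_path (M \<union> \<mu>) \<mu> i (Inl i # Inr x # p)"
      unfolding q augmenting_path_step using x j less.prems(6) unfolding \<mu>'_def by auto
    moreover have "set (Inl i # Inr x # p) \<subseteq> Inl ` Domain M \<union> Inr ` Range M"
    proof -
      have "Domain M' \<subseteq> Domain M" "Range M' \<subseteq> Range M" unfolding M'_def by auto
      then have "set p \<subseteq> Inl ` Domain M \<union> Inr ` Range M" using p(2) by blast
      then show ?thesis using x by auto
    qed
    ultimately show ?thesis by blast
  qed
qed

section \<open>The class at which the inner loop stops\<close>

text \<open>Edges of failed classes are discarded, so every attempt starts from the same
  \<open>E\<close> and the same matching. The outcome is therefore determined by the first class
  that admits a path, up to the choice of that path.\<close>

lemma process_agent_cases:
  assumes "process_agent C i l E \<mu> E' \<mu>'"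
    and "\<forall>k\<ge>l. \<forall>m\<ge>k. C i k = {} \<longrightarrow> C i m = {}"
  shows "E' = E \<and> \<mu>' = \<mu> \<and>
      (\<forall>k\<ge>l. C i k \<noteq> {} \<longrightarrow> (\<nexists>p. augmenting_path (E \<union> {i} \<times> C i k) \<mu> i p)) \<or>
    (\<exists>m p. l \<le> m \<and> E' = E \<union> {i} \<times> C i m \<and> \<mu>' = sym_diff \<mu> (path_edges p) \<and>
      augmenting_path (E \<union> {i} \<times> C i m) \<mu> i p \<and>
      (\<forall>k. l \<le> k \<and> k < m \<longrightarrow> (\<nexists>p. augmenting_path (E \<union> {i} \<times> C i k) \<mu> i p)))"
  using assms
proof (induction rule: process_agent.induct)
  case (exhausted l E \<mu>)
  \<comment> \<open>The loop stops at the first empty class it meets; all later classes are empty as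
    well, so nothing is left to refute.\<close>
  have "C i k = {}" if "l \<le> k" for k
    using exhausted.prems[rule_format, of l k] exhausted.hyps that by simp
  then show ?case by simp
next
  case (augment l E \<mu> p)
  then show ?case by (intro disjI2 exI[of _ l] exI[of _ p]) auto
next
  case (next_class l E \<mu> E' \<mu>')
  have split: "k = l \<or> l + 1 \<le> k" if "l \<le> k" for k using that by auto
  have "\<forall>k\<ge>l + 1. \<forall>m\<ge>k. C i k = {} \<longrightarrow> C i m = {}"
    using next_class.prems by (meson add_leD1)
  from next_class.IH[OF this] show ?case
  proof (elim disjE exE conjE)
    assume *: "E' = E" "\<mu>' = \<mu>"
      "\<forall>k\<ge>l + 1. C i k \<noteq> {} \<longrightarrow> (\<nexists>p. augmenting_path (E \<union> {i} \<times> C i k) \<mu> i p)"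
    have "\<nexists>p. augmenting_path (E \<union> {i} \<times> C i k) \<mu> i p" if "l \<le> k" "C i k \<noteq> {}" for k
      using split[OF that(1)] *(3) that(2) next_class.hyps(2) by (elim disjE) simp_all
    then show ?thesis using *(1,2) by simp
  next
    fix m p
    assume *: "l + 1 \<le> m" "E' = E \<union> {i} \<times> C i m" "\<mu>' = sym_diff \<mu> (path_edges p)"
      "augmenting_path (E \<union> {i} \<times> C i m) \<mu> i p"
      "\<forall>k. l + 1 \<le> k \<and> k < m \<longrightarrow> (\<nexists>p. augmenting_path (E \<union> {i} \<times> C i k) \<mu> i p)"
    have "\<nexists>p. augmenting_path (E \<union> {i} \<times> C i k) \<mu> i p" if "l \<le> k" "k < m" for k
      using split[OF that(1)] *(5) that(2) next_class.hyps(2) by (elim disjE) simp_all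
    moreover have "l \<le> m" using *(1) by simp
    ultimately show ?thesis using *(2-4) by (intro disjI2 exI[of _ m] exI[of _ p]) simp
  qed
qed

section \<open>Ranks of assigned objects\<close>

lemma partner_eq_Some:
  assumes "single_valued \<mu>" and "(i, x) \<in> \<mu>"
  shows "partner \<mu> i = Some x"
  unfolding partner_def using assms by (auto simp: single_valued_def intro!: the_equality)

lemma partner_eq_None: "i \<notin> Domain \<mu> \<Longrightarrow> partner \<mu> i = None"
  unfolding partner_def by auto

lemma rank_Some:
  assumes "house_allocation N Ob C" and "i \<in> N" and "k \<ge> 1" and "x \<in> C i k"
  shows "rank Ob C i (Some x) = k"
proof -
  have "l = k" if "1 \<le> l" "x \<in> C i l" for l
    using assms that unfolding house_allocation_def by (metis disjoint_iff)
  then have "(THE k. 1 \<le> k \<and> x \<in> C i k) = k"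
    by (intro the_equality conjI assms(3,4)) (elim conjE)
  moreover have "x \<in> acceptable C i" using assms(3,4) unfolding acceptable_def by auto
  ultimately show ?thesis unfolding rank_def by simp
qed

text \<open>Since empty classes come last, an object can be chosen from each of the classes 1 to
  \<open>k\<close>; the chosen objects are distinct because \<open>rank\<close> recovers the class.
  Hence the default rank \<open>card Ob + 1\<close> is worse than that of every acceptable
  object.\<close>

lemma nonempty_class_le_card:
  assumes ha: "house_allocation N Ob C" and i: "i \<in> N" and "C i k \<noteq> {}"
  shows "k \<le> card Ob"
proof -
  define f where "f l = (SOME x. x \<in> C i l)" for l
  have f: "f l \<in> C i l" if "l \<in> {1..k}" for l
  proof -
    have "\<forall>k\<ge>1. \<forall>m\<ge>k. C i k = {} \<longrightarrow> C i m = {}"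
      using ha i unfolding house_allocation_def by blast
    then have "C i l \<noteq> {}" using that assms(3) by (meson atLeastAtMost_iff)
    then show ?thesis unfolding f_def by (simp add: some_in_eq)
  qed
  have "rank Ob C i (Some (f l)) = l" if "l \<in> {1..k}" for l
    using rank_Some[OF ha i _ f[OF that]] that by auto
  then have "inj_on f {1..k}" by (rule inj_on_inverseI)
  moreover have "\<forall>k\<ge>1. C i k \<subseteq> Ob" using ha i unfolding house_allocation_def by blast
  then have "f ` {1..k} \<subseteq> Ob" using f by (meson atLeastAtMost_iff image_subsetI subsetD)
  moreover have "finite Ob" using ha unfolding house_allocation_def by blast
  ultimately show ?thesis using card_inj_on_le[of f "{1..k}" Ob] by simp
qed

text \<open>An unmatched agent has the default rank \<open>card Ob + 1\<close>, so a smaller rank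
  can only come from an edge of the matching.\<close>

lemma rank_le_card:
  assumes "house_allocation N Ob C" and "i \<in> N" and "is_matching N C M"
    and "rank Ob C i (partner M i) \<le> card Ob"
  obtains x where "(i, x) \<in> M" and "rank Ob C i (partner M i) \<ge> 1"
    and "x \<in> C i (rank Ob C i (partner M i))"
proof -
  have "partner M i \<noteq> None" using assms(4) by (auto simp: rank_def split: option.splits)
  then have "i \<in> Domain M" using partner_eq_None[of i M] by argo
  then obtain x where x: "(i, x) \<in> M" by blast
  have "single_valued M" using assms(3) unfolding is_matching_def single_valued_def by blast
  then have p: "partner M i = Some x" using x by (rule partner_eq_Some)
  have "x \<in> acceptable C i" using assms(3) x unfolding is_matching_def by blast
  then obtain k where k: "k \<ge> 1" "x \<in> C i k" unfolding acceptable_def by auto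
  have "rank Ob C i (partner M i) = k" unfolding p using rank_Some[OF assms(1,2) k] .
  then show thesis using that[OF x] k by simp
qed

section \<open>The invariant and its preservation\<close>

text \<open>\<open>D\<close> is the set of agents processed so far. The clause on
  \<open>C j l\<close> confines each matched agent to one class, so exchanges inside
  \<open>E\<close> leave it indifferent. The last clause is Pareto optimality on \<open>D\<close>,
  against matchings that may also use agents outside \<open>D\<close>.\<close>

definition sdmt_invariant ::
  "'a set \<Rightarrow> 'o set \<Rightarrow> ('a \<Rightarrow> nat \<Rightarrow> 'o set) \<Rightarrow> 'a set \<Rightarrow> ('a \<times> 'o) set \<Rightarrow> ('a \<times> 'o) set \<Rightarrow> bool" where
  "sdmt_invariant N Ob C D E \<mu> \<longleftrightarrow>
     finite \<mu> \<and> single_valued \<mu> \<and> single_valued (\<mu>\<inverse>) \<and> \<mu> \<subseteq> E \<and> Domain \<mu> \<subseteq> D \<and>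
     (\<forall>j\<in>D. j \<notin> Domain \<mu> \<longrightarrow> j \<notin> Domain E) \<and> Domain E \<subseteq> D \<and>
     (\<forall>j\<in>Domain \<mu>. \<exists>l\<ge>1. E `` {j} = C j l) \<and>
     (\<forall>M. is_matching N C M \<longrightarrow>
        (\<forall>j\<in>D. rank Ob C j (partner M j) \<le> rank Ob C j (partner \<mu> j)) \<longrightarrow>
        (\<forall>j\<in>D. rank Ob C j (partner M j) = rank Ob C j (partner \<mu> j)))"

text \<open>The edges of \<open>j\<close> in \<open>E\<close> form a single class, which therefore
  fixes the rank of whatever object \<open>j\<close> currently holds.\<close>

lemma invariant_rank:
  assumes ha: "house_allocation N Ob C" and "D \<subseteq> N" and "sdmt_invariant N Ob C D E \<mu>"
    and "j \<in> Domain \<mu>"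
  obtains l where "1 \<le> l" "l \<le> card Ob" "E `` {j} = C j l" "rank Ob C j (partner \<mu> j) = l"
proof -
  obtain x where x: "(j, x) \<in> \<mu>" using assms(4) by blast
  have jN: "j \<in> N" and "single_valued \<mu>" and "\<mu> \<subseteq> E"
    using assms(2-4) unfolding sdmt_invariant_def by auto
  obtain l where l: "1 \<le> l" "E `` {j} = C j l"
    using assms(3,4) unfolding sdmt_invariant_def by blast
  have xl: "x \<in> C j l" using x \<open>\<mu> \<subseteq> E\<close> l(2) by blast
  then have "l \<le> card Ob" using nonempty_class_le_card[OF ha jN] by blast
  moreover have "rank Ob C j (partner \<mu> j) = l"
    using rank_Some[OF ha jN l(1) xl] partner_eq_Some[OF \<open>single_valued \<mu>\<close> x] by simp
  ultimately show thesis using that l by blast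
qed

lemma better_match_augmenting_path:
  assumes ha: "house_allocation N Ob C" and DN: "D \<subseteq> N"
    and inv: "sdmt_invariant N Ob C D E \<mu>" and i: "i \<notin> D"
    and M: "is_matching N C M"
    and le: "\<forall>j\<in>D. rank Ob C j (partner M j) \<le> rank Ob C j (partner \<mu> j)"
    and x: "(i, x) \<in> M" "x \<in> C i k"
  shows "\<exists>p. augmenting_path (E \<union> {i} \<times> C i k) \<mu> i p"
proof -
  have eq: "rank Ob C j (partner M j) = rank Ob C j (partner \<mu> j)" if "j \<in> D" for j
    using inv M le that unfolding sdmt_invariant_def by blast
  have inv': "finite \<mu>" "single_valued \<mu>" "single_valued (\<mu>\<inverse>)" "\<mu> \<subseteq> E" "Domain \<mu> \<subseteq> D"
    using inv unfolding sdmt_invariant_def by blast+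
  have svM: "single_valued M" "single_valued (M\<inverse>)"
    using M unfolding is_matching_def single_valued_def by blast+
  \<comment> \<open>Agents not yet processed may use edges of \<open>M\<close> outside the graph;
    the restriction discards them but still covers every agent that an alternating walk from
    \<open>i\<close> can reach.\<close>
  define M' where "M' = {(j, y) \<in> M. j \<in> insert i (Domain \<mu>)}"
  \<comment> \<open>Equal ranks place the object that \<open>M\<close> gives to \<open>j\<close> in
    the very class whose edges \<open>E\<close> contains.\<close>
  have dom: "\<exists>y. (j, y) \<in> M \<and> (j, y) \<in> E" if j: "j \<in> Domain \<mu>" for j
  proof -
    have jD: "j \<in> D" "j \<in> N" using j inv'(5) DN by auto
    obtain l where l: "1 \<le> l" "l \<le> card Ob" "E `` {j} = C j l" "rank Ob C j (partner \<mu> j) = l"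
      using invariant_rank[OF ha DN inv j] .
    then have "rank Ob C j (partner M j) \<le> card Ob" using eq[OF jD(1)] by simp
    from rank_le_card[OF ha jD(2) M this] obtain y
      where "(j, y) \<in> M" "y \<in> C j (rank Ob C j (partner M j))" .
    then show ?thesis using eq[OF jD(1)] l(3,4) by auto
  qed
  have "(j, y) \<in> E \<union> {i} \<times> C i k" if M': "(j, y) \<in> M'" for j y
  proof (cases "j = i")
    case True
    then have "y = x'" if "(i, x') \<in> M" for x'
      using svM(1) M' that unfolding M'_def single_valued_def by simp
    then show ?thesis using True x by simp
  next
    case False
    then have M: "(j, y) \<in> M" "j \<in> Domain \<mu>" using M' unfolding M'_def by auto
    then obtain z where "(j, z) \<in> M" "(j, z) \<in> E" using dom by blast
    then show ?thesis using single_valuedD[OF svM(1) M(1)] by simp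
  qed
  then have sub: "M' \<union> \<mu> \<subseteq> E \<union> {i} \<times> C i k" using inv'(4) by auto
  have "single_valued M'" "single_valued (M'\<inverse>)"
    using svM unfolding M'_def single_valued_def by auto
  moreover have "insert i (Domain \<mu>) \<subseteq> Domain M'" using dom x unfolding M'_def by blast
  moreover have "i \<notin> Domain \<mu>" using i inv'(5) by blast
  ultimately obtain p where "augmenting_path (M' \<union> \<mu>) \<mu> i p"
    using augmenting_path_exists[OF inv'(1-3), of M' i] by blast
  then have "augmenting_path (E \<union> {i} \<times> C i k) \<mu> i p"
    using sub by (rule augmenting_path_mono)
  then show ?thesis by (rule exI)
qed

lemma process_agent_invariant:
  assumes ha: "house_allocation N Ob C" and DN: "insert i D \<subseteq> N" and i: "i \<notin> D"
    and inv: "sdmt_invariant N Ob C D E \<mu>" and pa: "process_agent C i 1 E \<mu> E' \<mu>'"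
  shows "sdmt_invariant N Ob C (insert i D) E' \<mu>'"
proof -
  have iN: "i \<in> N" and DN': "D \<subseteq> N" using DN by auto
  have inv': "finite \<mu>" "single_valued \<mu>" "single_valued (\<mu>\<inverse>)" "\<mu> \<subseteq> E" "Domain \<mu> \<subseteq> D"
    "\<forall>j\<in>D. j \<notin> Domain \<mu> \<longrightarrow> j \<notin> Domain E" "Domain E \<subseteq> D"
    "\<forall>j\<in>Domain \<mu>. \<exists>l\<ge>1. E `` {j} = C j l"
    "\<And>M. is_matching N C M \<Longrightarrow>
        (\<forall>j\<in>D. rank Ob C j (partner M j) \<le> rank Ob C j (partner \<mu> j)) \<Longrightarrow>
        (\<forall>j\<in>D. rank Ob C j (partner M j) = rank Ob C j (partner \<mu> j))"
    using inv unfolding sdmt_invariant_def by blast+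
  have "i \<notin> Domain E" using i inv'(7) by blast
  have i\<mu>: "i \<notin> Domain \<mu>" using i inv'(5) by blast
  \<comment> \<open>This serves both outcomes of the inner loop: earlier ranks are unchanged, and
    every nonempty class better than the new rank of \<open>i\<close> has failed. If
    \<open>i\<close> stays unmatched, its rank is the default value, and all its nonempty classes
    have failed.\<close>
  have optimal: "\<forall>M. is_matching N C M \<longrightarrow>
        (\<forall>j\<in>insert i D. rank Ob C j (partner M j) \<le> rank Ob C j (partner \<mu>' j)) \<longrightarrow>
        (\<forall>j\<in>insert i D. rank Ob C j (partner M j) = rank Ob C j (partner \<mu>' j))"
    if same: "\<forall>j\<in>D. rank Ob C j (partner \<mu>' j) = rank Ob C j (partner \<mu> j)"
      and bound: "rank Ob C i (partner \<mu>' i) \<le> card Ob + 1"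
      and no_path: "\<And>k. 1 \<le> k \<Longrightarrow> k < rank Ob C i (partner \<mu>' i) \<Longrightarrow> C i k \<noteq> {} \<Longrightarrow>
        \<nexists>p. augmenting_path (E \<union> {i} \<times> C i k) \<mu> i p"
  proof (intro allI impI)
    fix M
    assume M: "is_matching N C M"
      and le: "\<forall>j\<in>insert i D. rank Ob C j (partner M j) \<le> rank Ob C j (partner \<mu>' j)"
    have le': "\<forall>j\<in>D. rank Ob C j (partner M j) \<le> rank Ob C j (partner \<mu> j)"
      using le same by simp
    have "\<not> rank Ob C i (partner M i) < rank Ob C i (partner \<mu>' i)"
    proof
      assume less: "rank Ob C i (partner M i) < rank Ob C i (partner \<mu>' i)"
      \<comment> \<open>Being strictly below a rank of at most \<open>card Ob + 1\<close> means that
        \<open>i\<close> is matched in \<open>M\<close>, which supplies the object needed for the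
        augmenting path.\<close>
      then have "rank Ob C i (partner M i) \<le> card Ob" using bound by simp
      from rank_le_card[OF ha iN M this] obtain x where x: "(i, x) \<in> M"
        "rank Ob C i (partner M i) \<ge> 1" "x \<in> C i (rank Ob C i (partner M i))" .
      have "C i (rank Ob C i (partner M i)) \<noteq> {}" using x(3) by blast
      from no_path[OF x(2) less this] show False
        using better_match_augmenting_path[OF ha DN' inv i M le' x(1,3)] by (rule notE)
    qed
    then show "\<forall>j\<in>insert i D. rank Ob C j (partner M j) = rank Ob C j (partner \<mu>' j)"
      using inv'(9)[OF M le'] le same by simp
  qed
  have classes: "\<forall>k\<ge>1. \<forall>m\<ge>k. C i k = {} \<longrightarrow> C i m = {}"
    using ha iN unfolding house_allocation_def by blast
  consider (unmatched) "E' = E" "\<mu>' = \<mu>"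
      "\<And>k. 1 \<le> k \<Longrightarrow> C i k \<noteq> {} \<Longrightarrow> \<nexists>p. augmenting_path (E \<union> {i} \<times> C i k) \<mu> i p"
    | (augmented) m p where "1 \<le> m" "E' = E \<union> {i} \<times> C i m" "\<mu>' = sym_diff \<mu> (path_edges p)"
      "augmenting_path (E \<union> {i} \<times> C i m) \<mu> i p"
      "\<And>k. 1 \<le> k \<Longrightarrow> k < m \<Longrightarrow> \<nexists>p. augmenting_path (E \<union> {i} \<times> C i k) \<mu> i p"
    using process_agent_cases[OF pa classes] by (elim disjE exE conjE) simp_all
  then show ?thesis
  proof cases
    case unmatched
    have "rank Ob C i (partner \<mu>' i) = card Ob + 1"
      using partner_eq_None[OF i\<mu>] unmatched(2) by (simp add: rank_def)
    then have opt: "\<forall>M. is_matching N C M \<longrightarrow>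
        (\<forall>j\<in>insert i D. rank Ob C j (partner M j) \<le> rank Ob C j (partner \<mu>' j)) \<longrightarrow>
        (\<forall>j\<in>insert i D. rank Ob C j (partner M j) = rank Ob C j (partner \<mu>' j))"
      using unmatched by (intro optimal) simp_all
    have "\<forall>j\<in>insert i D. j \<notin> Domain \<mu> \<longrightarrow> j \<notin> Domain E"
      using inv'(6) \<open>i \<notin> Domain E\<close> by blast
    then show ?thesis
      using opt unfolding sdmt_invariant_def unmatched(1,2)
      by (intro conjI inv'(1-4,8) subset_insertI2[OF inv'(5)] subset_insertI2[OF inv'(7)])
  next
    case (augmented m p)
    have Ei: "E' `` {i} = C i m" using \<open>i \<notin> Domain E\<close> unfolding augmented(2) by auto
    have Ej: "E' `` {j} = E `` {j}" if "j \<noteq> i" for j using that unfolding augmented(2) by auto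
    have \<mu>': "single_valued \<mu>'" "single_valued (\<mu>'\<inverse>)" "finite \<mu>'" "\<mu>' \<subseteq> E'"
      "Domain \<mu>' = insert i (Domain \<mu>)"
      using augment_matching[OF augmented(4) inv'(2,3,1) _ i\<mu>] inv'(4)
      unfolding augmented(2,3) by auto
    \<comment> \<open>The new matching lies inside \<open>E'\<close>, so a matched agent has the
      rank of its single class, whichever path was chosen.\<close>
    have \<mu>'_rank: "rank Ob C j (partner \<mu>' j) = l"
      if "j \<in> Domain \<mu>'" "1 \<le> l" "E' `` {j} = C j l" "j \<in> N" for j l
    proof -
      obtain x where x: "(j, x) \<in> \<mu>'" using \<open>j \<in> Domain \<mu>'\<close> by blast
      then have "x \<in> C j l" using \<mu>'(4) that(3) by blast
      then show ?thesis using rank_Some[OF ha that(4,2)] partner_eq_Some[OF \<mu>'(1) x] by simp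
    qed
    have "\<forall>j\<in>D. rank Ob C j (partner \<mu>' j) = rank Ob C j (partner \<mu> j)"
    proof
      fix j assume j: "j \<in> D"
      then have ji: "j \<noteq> i" using i by blast
      show "rank Ob C j (partner \<mu>' j) = rank Ob C j (partner \<mu> j)"
      proof (cases "j \<in> Domain \<mu>")
        case True
        obtain l where l: "1 \<le> l" "E `` {j} = C j l" "rank Ob C j (partner \<mu> j) = l"
          using invariant_rank[OF ha DN' inv True] by metis
        then show ?thesis using \<mu>'_rank[of j l] \<mu>'(5) True Ej[OF ji] j DN' by auto
      next
        case False
        \<comment> \<open>Augmenting adds only \<open>i\<close> to the domain, so an earlier
          unmatched agent keeps the default rank.\<close>
        then have "j \<notin> Domain \<mu>'" using \<mu>'(5) ji by blast
        then show ?thesis using False by (simp add: partner_eq_None)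
      qed
    qed
    moreover have rank_i: "rank Ob C i (partner \<mu>' i) = m"
      using \<mu>'_rank[of i m] \<mu>'(5) augmented(1) Ei iN by simp
    moreover have "C i m \<noteq> {}" using \<mu>'(4,5) Ei by blast
    then have "m \<le> card Ob + 1" using nonempty_class_le_card[OF ha iN] by fastforce
    ultimately have opt: "\<forall>M. is_matching N C M \<longrightarrow>
        (\<forall>j\<in>insert i D. rank Ob C j (partner M j) \<le> rank Ob C j (partner \<mu>' j)) \<longrightarrow>
        (\<forall>j\<in>insert i D. rank Ob C j (partner M j) = rank Ob C j (partner \<mu>' j))"
      using augmented(5) by (intro optimal) simp_all
    have "\<forall>j\<in>Domain \<mu>'. \<exists>l\<ge>1. E' `` {j} = C j l"
      using \<mu>'(5) Ei Ej augmented(1) inv'(8) by (metis insert_iff)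
    moreover have "\<forall>j\<in>insert i D. j \<notin> Domain \<mu>' \<longrightarrow> j \<notin> Domain E'"
      using \<mu>'(5) inv'(6) unfolding augmented(2) by auto
    moreover have "Domain E' \<subseteq> insert i D" "Domain \<mu>' \<subseteq> insert i D"
      using inv'(5,7) \<mu>'(5) unfolding augmented(2) by auto
    ultimately show ?thesis unfolding sdmt_invariant_def using \<mu>'(1-4) opt by blast
  qed
qed

section \<open>The complete run\<close>

text \<open>\<open>D\<close> is left general because the induction follows the remaining agents
  while the processed set grows.\<close>

lemma process_agents_invariant:
  assumes "process_agents C \<sigma> E \<mu> E' \<mu>'" and "house_allocation N Ob C"
    and "distinct \<sigma>" and "set \<sigma> \<inter> D = {}" and "set \<sigma> \<union> D \<subseteq> N"
    and "sdmt_invariant N Ob C D E \<mu>"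
  shows "sdmt_invariant N Ob C (set \<sigma> \<union> D) E' \<mu>'"
  using assms
proof (induction arbitrary: D rule: process_agents.induct)
  case (1 E \<mu>)
  then show ?case by simp
next
  case (2 i E \<mu> E' \<mu>' "is" E'' \<mu>'')
  have "sdmt_invariant N Ob C (insert i D) E' \<mu>'"
    by (rule process_agent_invariant[OF "2.prems"(1) _ _ "2.prems"(5) "2.hyps"(1)])
      (use "2.prems"(3,4) in auto)
  then have "sdmt_invariant N Ob C (set is \<union> insert i D) E'' \<mu>''"
    by (intro "2.IH" "2.prems"(1)) (use "2.prems"(2-4) in auto)
  then show ?case by simp
qed

theorem corollary3p3:
  fixes N :: "'a set" and Ob :: "'o set" and C :: "'a \<Rightarrow> nat \<Rightarrow> 'o set"
    and \<sigma> :: "'a list" and \<mu> :: "('a \<times> 'o) set"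
  assumes "house_allocation N Ob C"
    and "distinct \<sigma>" and "set \<sigma> = N"
    and "sdmt1_returns C \<sigma> \<mu>"
  shows "is_matching N C \<mu> \<and> pareto_optimal N Ob C \<mu>"
proof -
  obtain E where run: "process_agents C \<sigma> {} {} E \<mu>"
    using assms(4) unfolding sdmt1_returns_def by blast
  have "sdmt_invariant N Ob C {} {} {}" by (simp add: sdmt_invariant_def)
  from process_agents_invariant[OF run assms(1,2) _ _ this]
  have inv: "sdmt_invariant N Ob C N E \<mu>" using assms(3) by simp
  have inv': "single_valued \<mu>" "single_valued (\<mu>\<inverse>)" "\<mu> \<subseteq> E" "Domain \<mu> \<subseteq> N"
    "\<forall>j\<in>Domain \<mu>. \<exists>l\<ge>1. E `` {j} = C j l"
    using inv unfolding sdmt_invariant_def by blast+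
  \<comment> \<open>Acceptability follows from the confinement of each matched agent to one of its
    classes.\<close>
  have "j \<in> N \<and> x \<in> acceptable C j" if jx: "(j, x) \<in> \<mu>" for j x
  proof -
    obtain l where l: "l \<ge> 1" "E `` {j} = C j l" using inv'(5) jx by blast
    have "(j, x) \<in> E" using jx inv'(3) by blast
    then have "x \<in> C j l" using l(2) by blast
    then have "x \<in> acceptable C j" using l(1) unfolding acceptable_def by blast
    then show ?thesis using jx inv'(4) by blast
  qed
  then have "is_matching N C \<mu>"
    unfolding is_matching_def using single_valuedD[OF inv'(1)] single_valuedD[OF inv'(2)]
    by fastforce
  moreover have "pareto_optimal N Ob C \<mu>"
    unfolding pareto_optimal_def
  proof clarify
    fix \<mu>' i
    assume M: "is_matching N C \<mu>'" and i: "i \<in> N"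
      and weak: "\<forall>i\<in>N. weakly_prefers Ob C i (partner \<mu>' i) (partner \<mu> i)"
      and strict: "strictly_prefers Ob C i (partner \<mu>' i) (partner \<mu> i)"
    \<comment> \<open>Now that all agents are processed, the last clause of the invariant turns weak
      improvement into equality of ranks, which excludes the strict improvement of
      \<open>i\<close>.\<close>
    have "\<forall>M. is_matching N C M \<longrightarrow>
        (\<forall>j\<in>N. rank Ob C j (partner M j) \<le> rank Ob C j (partner \<mu> j)) \<longrightarrow>
        (\<forall>j\<in>N. rank Ob C j (partner M j) = rank Ob C j (partner \<mu> j))"
      using inv unfolding sdmt_invariant_def by (elim conjE)
    from this[rule_format, OF M weak[unfolded weakly_prefers_def, THEN bspec]]
    have "rank Ob C i (partner \<mu>' i) = rank Ob C i (partner \<mu> i)" using i by simp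
    then show False using strict i unfolding strictly_prefers_def by simp
  qed
  ultimately show ?thesis ..
qed

end
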